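(* For all integers $n\ge 0$ and $k\ge 1$, $$F(n+2k;\,n,\,0)=\sum_{s=1}^{k}\sum_{t=0}^{s}\frac{s-t+1}{n+2}\binom{n+2}{s+1}\binom{n+2}{t}F(2k-1;\,2s-1,\,s-t).$$
   Context: For integers $m\ge 0$ and $n_1,n_2$, $F(m;n_1,n_2)$ denotes the number of Gessel walks with exactly $m$ steps from $(0,0)$ to $(n_1,n_2)$: lattice walks starting at the origin, each of whose $m$ steps is one of West $(-1,0)$, North-East $(1,1)$, East $(1,0)$, South-West $(-1,-1)$, and which remain in the first quadrant $\{(i,j): i\ge 0, j\ge 0\}$. In particular $F(m;n_1,n_2)=0$ if $n_1<0$ or $n_2<0$, and $F(0;n_1,n_2)=1$ if $n_1=n_2=0$ and $0$ otherwise. Binomial coefficients $\binom{a}{b}$ with $a\ge 0$ are $0$ when $b>a$. *)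

theory Defs
  imports Complex_Main "HOL-Library.Product_Plus"
begin

definition gessel_steps :: "(int \<times> int) set" where
  "gessel_steps = {(-1, 0), (1, 1), (1, 0), (-1, -1)}"

definition quadrant :: "(int \<times> int) set" where
  "quadrant = {(i, j). 0 \<le> i \<and> 0 \<le> j}"

text \<open>
  A walk is represented by its list of steps; the point reached after \<open>r\<close> steps is the
  componentwise sum of the first \<open>r\<close> entries, the walk starting at \<open>(0, 0)\<close>.
\<close>

definition gessel_walks :: "nat \<Rightarrow> int \<Rightarrow> int \<Rightarrow> (int \<times> int) list set" where
  "gessel_walks m n1 n2 =
     {w. length w = m \<and> set w \<subseteq> gessel_steps \<and>
         (\<forall>r\<le>m. sum_list (take r w) \<in> quadrant) \<and> sum_list w = (n1, n2)}"

definition F :: "nat \<Rightarrow> int \<Rightarrow> int \<Rightarrow> nat" where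
  "F m n1 n2 = card (gessel_walks m n1 n2)"

end

theory Submission
  imports Defs "HOL-Library.Groups_Big_Fun"
begin

text \<open>
  Cut a walk from the origin to \<open>(n, 0)\<close> of length \<open>n + 2k\<close> after \<open>2k - 1\<close> steps. At that moment the
  abscissa is odd, hence at least 1, and the remaining \<open>n + 1\<close> steps are too few to visit abscissa
  \<open>-1\<close> and then still reach abscissa \<open>n\<close>. So on the final part only the constraint \<open>y \<ge> 0\<close> matters,
  and by the reflection principle the number of such final parts starting from \<open>(2s - 1, s - t)\<close> is
  the 2-by-2 binomial determinant occurring as coefficient. Instead of
  reflecting paths, we move the cut one step at a time.
\<close>

section \<open>Last-step recursion and support of \<open>F\<close>\<close>

lemma gessel_walks_outside: "(x, y) \<notin> quadrant \<Longrightarrow> gessel_walks m x y = {}"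
  by (auto simp: gessel_walks_def)

lemma finite_gessel_walks: "finite (gessel_walks m x y)"
proof (rule finite_subset)
  show "gessel_walks m x y \<subseteq> {w. set w \<subseteq> gessel_steps \<and> length w = m}"
    by (auto simp: gessel_walks_def)
  show "finite {w. set w \<subseteq> gessel_steps \<and> length w = m}"
    by (rule finite_lists_length_eq) (simp add: gessel_steps_def)
qed

lemma gessel_walks_Suc:
  assumes "(x, y) \<in> quadrant"
  shows "gessel_walks (Suc m) x y =
    (\<Union>(a, b)\<in>gessel_steps. (\<lambda>w. w @ [(a, b)]) ` gessel_walks m (x - a) (y - b))"
    (is "?L = ?R")
proof (intro set_eqI iffI)
  fix w assume w: "w \<in> ?L"
  then have "w \<noteq> []"
    by (auto simp: gessel_walks_def)
  then obtain v a b where v: "w = v @ [(a, b)]"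
    by (metis append_butlast_last_id surj_pair)
  have "sum_list (take r v) \<in> quadrant" if "r \<le> m" for r
  proof -
    have "sum_list (take r w) \<in> quadrant"
      using that w unfolding gessel_walks_def by (simp del: take_append)
    moreover have "take r w = take r v"
      using that w by (simp add: v gessel_walks_def)
    ultimately show ?thesis by simp
  qed
  moreover have "sum_list v + (a, b) = (x, y)"
    using w by (simp add: v gessel_walks_def)
  then have "sum_list v = (x - a, y - b)"
    by (cases "sum_list v") auto
  ultimately have "v \<in> gessel_walks m (x - a) (y - b)" "(a, b) \<in> gessel_steps"
    using w by (auto simp: gessel_walks_def v)
  then show "w \<in> ?R"
    using v by blast
next
  fix w assume "w \<in> ?R"
  then obtain v a b where "w = v @ [(a, b)]" "(a, b) \<in> gessel_steps"
    "v \<in> gessel_walks m (x - a) (y - b)"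
    by auto
  with assms show "w \<in> ?L"
    by (auto simp: gessel_walks_def le_Suc_eq)
qed

lemma F_outside: "x < 0 \<or> y < 0 \<Longrightarrow> F m x y = 0"
  by (auto simp: F_def quadrant_def gessel_walks_outside)

lemma F_0: "F 0 x y = (if x = 0 \<and> y = 0 then 1 else 0)"
proof -
  have "gessel_walks 0 x y = (if x = 0 \<and> y = 0 then {[]} else {})"
    by (auto simp: gessel_walks_def quadrant_def zero_prod_def)
  then show ?thesis
    by (simp add: F_def)
qed

lemma F_Suc:
  assumes "x \<ge> 0" "y \<ge> 0"
  shows "F (Suc m) x y =
    F m (x + 1) y + F m (x - 1) (y - 1) + F m (x - 1) y + F m (x + 1) (y + 1)"
proof -
  have "F (Suc m) x y =
      card (\<Union>(a, b)\<in>gessel_steps. (\<lambda>w. w @ [(a, b)]) ` gessel_walks m (x - a) (y - b))"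
    using assms by (simp add: F_def gessel_walks_Suc quadrant_def)
  also have "\<dots> = (\<Sum>(a, b)\<in>gessel_steps. card ((\<lambda>w. w @ [(a, b)]) ` gessel_walks m (x - a) (y - b)))"
    by (subst card_UN_disjoint)
      (auto simp: gessel_steps_def finite_gessel_walks case_prod_unfold)
  also have "\<dots> = (\<Sum>(a, b)\<in>gessel_steps. F m (x - a) (y - b))"
    by (simp add: F_def card_image inj_on_def)
  finally show ?thesis
    by (simp add: gessel_steps_def)
qed

text \<open>Each step raises the abscissa by at most one; this bounds \<open>s\<close> by
  \<open>k\<close> in the final sum.\<close>

lemma F_beyond: "x > int m \<Longrightarrow> F m x y = 0"
proof (induction m arbitrary: x y)
  case 0
  then show ?case by (simp add: F_0)
next
  case (Suc m)
  then show ?case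
    by (cases "y < 0") (simp_all add: F_outside F_Suc)
qed

section \<open>Signed counts of half-plane paths\<close>

definition int_choose :: "nat \<Rightarrow> int \<Rightarrow> int" where
  "int_choose N i = (if i < 0 then 0 else int (N choose nat i))"

text \<open>Extension by 0 to negative lower indices makes Pascal's rule hold at every integer,
  boundary included.\<close>

lemma int_choose_Suc: "int_choose (Suc N) i = int_choose N i + int_choose N (i - 1)"
proof (cases "i \<ge> 1")
  case True
  then have "nat i = Suc (nat (i - 1))" by simp
  then show ?thesis using True by (simp add: int_choose_def)
next
  case False
  then show ?thesis by (cases "i = 0") (auto simp: int_choose_def)
qed

lemma int_choose_0: "int_choose 0 i = (if i = 0 then 1 else 0)"
  by (simp add: int_choose_def binomial_eq_0)

lemma int_choose_eq_0: "i < 0 \<or> i > int N \<Longrightarrow> int_choose N i = 0"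
  by (auto simp: int_choose_def binomial_eq_0)

text \<open>
  For \<open>t \<le> s\<close> this counts the walks of \<open>N\<close> steps from height \<open>s - t\<close> to height 0 which remain at
  height \<open>\<ge> 0\<close> and have exactly \<open>s\<close> steps to the left. For \<open>t > s\<close> it is minus the count for the
  reflected starting point (0 on the mirror line \<open>t = s + 1\<close>).
\<close>

definition half_plane_paths :: "nat \<Rightarrow> int \<Rightarrow> int \<Rightarrow> int" where
  "half_plane_paths N s t =
     int_choose N s * int_choose N t - int_choose N (s + 1) * int_choose N (t - 1)"

text \<open>The four terms sort by first step: East, West, North-East, South-West. Algebraically,
  Pascal's rule expands every factor.\<close>

lemma half_plane_paths_Suc:
  "half_plane_paths (Suc N) s t =
     half_plane_paths N s t + half_plane_paths N (s - 1) (t - 1)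
     + half_plane_paths N s (t - 1) + half_plane_paths N (s - 1) t"
  by (simp add: half_plane_paths_def int_choose_Suc algebra_simps)

lemma half_plane_paths_support:
  "half_plane_paths N s t \<noteq> 0 \<Longrightarrow> s \<in> {-1..int N} \<and> t \<in> {0..int N + 1}"
  by (rule ccontr) (auto simp: half_plane_paths_def not_le int_choose_eq_0)

lemma half_plane_paths_below: "half_plane_paths N s (s + 1) = 0"
  by (simp add: half_plane_paths_def)

section \<open>Sums invariant under moving the cut\<close>

text \<open>
  A walk reaching \<open>(n, 0)\<close> whose last \<open>j\<close> steps include \<open>s\<close> steps to the left starts these last steps
  at abscissa \<open>n - j + 2s\<close>.
\<close>

definition cut_sum :: "nat \<Rightarrow> nat \<Rightarrow> nat \<Rightarrow> int" where
  "cut_sum n j m =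
     Sum_any (\<lambda>(s, t). int (F m (int n - int j + 2 * s) (s - t)) * half_plane_paths j s t)"

lemma Sum_any_shift:
  fixes f :: "int \<times> int \<Rightarrow> 'a::comm_monoid_add"
  shows "Sum_any (\<lambda>(s, t). f (s + a, t + b)) = Sum_any f"
proof (rule Sum_any.reindex_cong[symmetric, where l = "\<lambda>(s, t). (s + a, t + b)"])
  show "bij (\<lambda>(s, t). (s + a, t + b))"
    by (rule o_bij[where g = "\<lambda>(s, t). (s - a, t - b)"]) auto
qed auto

lemma Sum_any_add4:
  assumes "finite {p. f p \<noteq> 0}" "finite {p. g p \<noteq> 0}"
    and "finite {p. h p \<noteq> 0}" "finite {p. k p \<noteq> (0::'b::comm_monoid_add)}"
  shows "Sum_any (\<lambda>p. f p + g p + h p + k p) = Sum_any f + Sum_any g + Sum_any h + Sum_any k"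
proof -
  have fin: "finite {p. u p + v p \<noteq> 0}"
    if "finite {p. u p \<noteq> 0}" "finite {p. v p \<noteq> (0::'b)}" for u v :: "'a \<Rightarrow> 'b"
    by (rule finite_subset[OF _ finite_UnI[OF that]]) auto
  show ?thesis
    using assms by (simp add: Sum_any.distrib fin)
qed

lemma finite_half_plane_paths_support:
  "finite {p. (case p of (s, t) \<Rightarrow> g s t * half_plane_paths j (s + a) (t + b)) \<noteq> 0}"
proof (rule finite_subset)
  show "{p. (case p of (s, t) \<Rightarrow> g s t * half_plane_paths j (s + a) (t + b)) \<noteq> 0}
      \<subseteq> {-1 - a..int j - a} \<times> {-b..int j + 1 - b}"
    using half_plane_paths_support by fastforce
qed simp

text \<open>Splitting off the last step before the cut by \<open>F_Suc\<close> and regrouping it as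
  first step after the cut moves the cut one step towards the origin.\<close>

lemma cut_sum_step:
  assumes "j \<le> n"
  shows "cut_sum n j (Suc m) = cut_sum n (Suc j) m"
proof -
  define f where "f s t = int (F m (int n - int (Suc j) + 2 * s) (s - t))" for s t
  let ?D = "half_plane_paths j"
  have step: "int (F (Suc m) (int n - int j + 2 * s) (s - t)) * ?D s t
      = f s t * ?D s t + f (s + 1) (t + 1) * ?D s t + f s (t + 1) * ?D s t + f (s + 1) t * ?D s t"
    for s t
  proof (cases "?D s t = 0")
    case False
    \<comment> \<open>On the mirror line \<open>t = s + 1\<close> the recursion of \<open>F\<close>
      can fail, as one neighbour has height 0; but there \<open>?D\<close> vanishes.\<close>
    then have s: "s \<ge> -1" "t \<ge> 0" and "t \<noteq> s + 1"
      using half_plane_paths_support half_plane_paths_below by fastforce+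
    show ?thesis
    proof (cases "t \<le> s")
      case True
      \<comment> \<open>Now \<open>s \<ge> t \<ge> 0\<close>, and \<open>j \<le> n\<close> keeps the
        abscissa inside the quadrant.\<close>
      then have "int n - int j + 2 * s \<ge> 0"
        using s assms by simp
      with True show ?thesis
        by (simp add: f_def F_Suc algebra_simps)
    next
      \<comment> \<open>Below the mirror line all heights involved are negative, so both sides are
        0.\<close>
      case False
      with \<open>t \<noteq> s + 1\<close> show ?thesis
        by (simp add: f_def F_outside)
    qed
  qed simp
  \<comment> \<open>Reindexing carries the shifts from \<open>f\<close> over to \<open>?D\<close>,
    as \<open>half_plane_paths_Suc\<close> requires.\<close>
  have shift: "Sum_any (\<lambda>(s, t). f (s + a) (t + b) * ?D s t)
      = Sum_any (\<lambda>(s, t). f s t * ?D (s - a) (t - b))" for a b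
    using Sum_any_shift[of "\<lambda>(s, t). f s t * ?D (s - a) (t - b)" a b] by simp
  have "cut_sum n j (Suc m) =
      Sum_any (\<lambda>(s, t). f s t * ?D s t) + Sum_any (\<lambda>(s, t). f (s + 1) (t + 1) * ?D s t)
      + Sum_any (\<lambda>(s, t). f s (t + 1) * ?D s t) + Sum_any (\<lambda>(s, t). f (s + 1) t * ?D s t)"
    unfolding cut_sum_def step
    by (subst Sum_any_add4[symmetric])
      (use finite_half_plane_paths_support[where j = j and a = 0 and b = 0] in
        \<open>simp_all add: case_prod_unfold\<close>)
  also have "\<dots> = Sum_any (\<lambda>(s, t). f s t * ?D s t) + Sum_any (\<lambda>(s, t). f s t * ?D (s - 1) (t - 1))
      + Sum_any (\<lambda>(s, t). f s t * ?D s (t - 1)) + Sum_any (\<lambda>(s, t). f s t * ?D (s - 1) t)"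
    using shift[of 1 1] shift[of 0 1] shift[of 1 0] by simp
  also have "\<dots> = cut_sum n (Suc j) m"
    unfolding cut_sum_def half_plane_paths_Suc f_def[symmetric]
    by (subst Sum_any_add4[symmetric])
      (use finite_half_plane_paths_support[where j = j and a = 0 and b = 0]
           finite_half_plane_paths_support[where j = j and a = "- 1" and b = 0]
           finite_half_plane_paths_support[where j = j and a = 0 and b = "- 1"]
           finite_half_plane_paths_support[where j = j and a = "- 1" and b = "- 1"] in
        \<open>simp_all add: case_prod_unfold algebra_simps\<close>)
  finally show ?thesis .
qed

lemma cut_sum_invariant:
  assumes "j \<le> Suc n"
  shows "cut_sum n 0 (m + j) = cut_sum n j m"
  using assms
proof (induction j arbitrary: m)
  case (Suc j)
  then show ?case
    using cut_sum_step[of j n m] Suc.IH[of "Suc m"] by simp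
qed simp

lemma cut_sum_0: "cut_sum n 0 m = int (F m (int n) 0)"
proof -
  have "(case p of (s, t) \<Rightarrow> int (F m (int n - int 0 + 2 * s) (s - t)) * half_plane_paths 0 s t)
      = (if p = (0, 0) then int (F m (int n) 0) else 0)" for p
  proof (cases p)
    case (Pair s t)
    \<comment> \<open>The entry -1 belongs to the reflected point, whose height -2 makes
      \<open>F\<close> vanish.\<close>
    have "half_plane_paths 0 s t =
        (if s = 0 \<and> t = 0 then 1 else if s = -1 \<and> t = 1 then -1 else 0)"
      by (auto simp: half_plane_paths_def int_choose_0)
    then show ?thesis
      by (auto simp: Pair F_outside)
  qed
  then show ?thesis
    by (simp add: cut_sum_def)
qed

lemma half_plane_paths_coefficient:
  "of_int (half_plane_paths (Suc n) (int s) (int t)) =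
     (real s - real t + 1) / (real n + 2) * real ((n + 2) choose (s + 1)) * real ((n + 2) choose t)"
proof -
  let ?a = "real (Suc n choose s)" and ?b = "real (Suc n choose Suc s)"
  \<comment> \<open>Absorption for \<open>(n + 2) choose (i + 1)\<close>, with that binomial split
    by Pascal's rule.\<close>
  have absorb: "(real i + 1) * (real (Suc n choose i) + real (Suc n choose Suc i))
      = (real n + 2) * real (Suc n choose i)" for i
    using arg_cong[OF Suc_times_binomial[of i "Suc n"], of real]
    by (simp add: algebra_simps)
  have s: "nat (int s + 1) = Suc s" by simp
  show ?thesis
  proof (cases t)
    case 0
    then show ?thesis
      using absorb[of s] by (simp add: half_plane_paths_def int_choose_def s field_simps)
  next
    case (Suc i)
    let ?c = "real (Suc n choose i)" and ?d = "real (Suc n choose Suc i)"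
    have "(real n + 2) * (?a * ?d - ?b * ?c)
        = ((real n + 2) * ?a) * (?c + ?d) - ((real n + 2) * ?c) * (?a + ?b)"
      by (simp add: algebra_simps)
    also have "\<dots> = (real s - real i) * (?a + ?b) * (?c + ?d)"
      unfolding absorb[symmetric] by (simp add: algebra_simps)
    finally have "?a * ?d - ?b * ?c = (real s - real i) / (real n + 2) * (?a + ?b) * (?c + ?d)"
      by (simp add: field_simps)
    moreover have "nat (1 + int i) = Suc i" by simp
    ultimately show ?thesis
      by (simp add: Suc half_plane_paths_def int_choose_def s del: binomial_Suc_Suc)
        (simp add: numeral_2_eq_2 add.commute)
  qed
qed

theorem theorem5:
  fixes n k :: nat
  assumes "k \<ge> 1"
  shows "real (F (n + 2 * k) (int n) 0) =
    (\<Sum>s = 1..k. \<Sum>t = 0..s.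
       (real s - real t + 1) / (real n + 2)
         * real ((n + 2) choose (s + 1)) * real ((n + 2) choose t)
         * real (F (2 * k - 1) (2 * int s - 1) (int s - int t)))"
proof -
  \<comment> \<open>At \<open>j = n + 1\<close> the abscissa of the cut point becomes
    \<open>2 * s - 1\<close>.\<close>
  define g where "g = (\<lambda>(s, t). int (F (2 * k - 1) (2 * s - 1) (s - t)) * half_plane_paths (Suc n) s t)"
  define A where "A = (SIGMA s:{1..k}. {0..s})"
  have support: "{p. g p \<noteq> 0} \<subseteq> (\<lambda>(s, t). (int s, int t)) ` A"
  proof
    fix p assume p: "p \<in> {p. g p \<noteq> 0}"
    obtain s t where st: "p = (s, t)" by (cases p)
    have "F (2 * k - 1) (2 * s - 1) (s - t) \<noteq> 0" "half_plane_paths (Suc n) s t \<noteq> 0"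
      using p by (auto simp: g_def st)
    \<comment> \<open>The factor \<open>F\<close> forces \<open>1 \<le> s \<le> k\<close> (the lower
      bound by parity) and \<open>t \<le> s\<close>; the other factor gives
      \<open>t \<ge> 0\<close>.\<close>
    moreover from this have "0 \<le> 2 * s - 1" "t \<le> s" "2 * s - 1 \<le> int (2 * k - 1)"
      by (metis F_outside not_less, metis F_outside diff_less_0_iff_less not_less,
          metis F_beyond not_less)
    ultimately have "0 \<le> 2 * s - 1" "t \<le> s" "2 * s - 1 \<le> int (2 * k - 1)" "t \<ge> 0"
      using half_plane_paths_support[of "Suc n" s t] by simp_all
    then have "(nat s, nat t) \<in> A" "p = (int (nat s), int (nat t))"
      using assms by (auto simp: A_def st)
    then show "p \<in> (\<lambda>(s, t). (int s, int t)) ` A"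
      by force
  qed
  have "int (F (n + 2 * k) (int n) 0) = cut_sum n (Suc n) (2 * k - 1)"
    using cut_sum_invariant[of "Suc n" n "2 * k - 1"] assms by (simp add: cut_sum_0 add.commute)
  also have "\<dots> = Sum_any g"
    by (simp add: cut_sum_def g_def)
  also have "\<dots> = sum g ((\<lambda>(s, t). (int s, int t)) ` A)"
    by (rule Sum_any.expand_superset[OF _ support]) (simp add: A_def)
  also have "\<dots> = (\<Sum>(s, t)\<in>A. g (int s, int t))"
    by (subst sum.reindex) (auto simp: inj_on_def case_prod_unfold)
  also have "\<dots> = (\<Sum>s = 1..k. \<Sum>t = 0..s. g (int s, int t))"
    unfolding A_def by (subst sum.Sigma) auto
  finally have "real_of_int (int (F (n + 2 * k) (int n) 0)) =
      (\<Sum>s = 1..k. \<Sum>t = 0..s. real_of_int (g (int s, int t)))"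
    by simp
  then show ?thesis
    by (simp add: g_def half_plane_paths_coefficient mult.commute del: binomial_Suc_Suc)
qed

end
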